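(* Let $M$ be a smooth manifold, let $\mathcal G$ be any generalized metric on $\mathbb TM=TM\oplus T^*M$, and let $\mathcal F_0$ be the natural generalized almost paracomplex structure. (i) If $\mathcal G$ is a Riemannian metric, then $(\mathcal F_0,\mathcal G)$ is a generalized almost para-Norden structure if and only if $\mathcal G(X,\xi)=0$ for all $X\in\mathfrak X(M)$, $\xi\in\Lambda^1(M)$. (ii) If $\mathcal G$ is a pseudo-Riemannian metric, then $(\mathcal F_0,\mathcal G)$ is a generalized pseudo-Riemannian almost product structure if and only if $\mathcal G(X,\xi)=0$ for all $X\in\mathfrak X(M)$, $\xi\in\Lambda^1(M)$; and $(\mathcal F_0,\mathcal G)$ is a generalized almost para-Hermitian structure if and only if $\mathcal G(X,Y)=\mathcal G(\xi,\eta)=0$ for all $X,Y\in\mathfrak X(M)$ and $\xi,\eta\in\Lambda^1(M)$.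
   Context: $\mathfrak F(M)$ is the ring of smooth functions, $\mathfrak X(M)$ the vector fields, $\Lambda^1(M)$ the 1-forms; sections of $\mathbb TM$ are written $X+\xi$ with $X\in\mathfrak X(M)$, $\xi\in\Lambda^1(M)$. A generalized metric is an $\mathfrak F(M)$-bilinear, symmetric, nondegenerate map $\mathcal G\colon\Gamma(\mathbb TM)\times\Gamma(\mathbb TM)\to\mathfrak F(M)$; it is Riemannian if positive definite and pseudo-Riemannian if not positive definite. The natural generalized almost paracomplex structure is $\mathcal F_0(X+\xi)=-X+\xi$. For an $\mathfrak F(M)$-linear endomorphism $\mathcal F$ of $\Gamma(\mathbb TM)$ with $\mathcal F^2=Id$ and a generalized metric $\mathcal G$: if $\mathcal G(\mathcal Fu,\mathcal Fv)=\mathcal G(u,v)$ for all $u,v$, the pair $(\mathcal F,\mathcal G)$ is a generalized Riemannian (resp. pseudo-Riemannian) almost product structure when $\mathcal G$ is Riemannian (resp. pseudo-Riemannian), and a generalized almost para-Norden structure when $\mathcal G$ is Riemannian and the $\pm1$-eigenbundles of $\mathcal F$ have the same rank; if $\mathcal G(\mathcal Fu,\mathcal Fv)=-\mathcal G(u,v)$ for all $u,v$, the pair is a generalized almost para-Hermitian structure. *)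

theory Defs
  imports "HOL-Analysis.Analysis" "HOL-Library.Function_Algebras"
begin

section \<open>Smooth manifolds\<close>

fun Ck_on :: "nat \<Rightarrow> 'b::real_normed_vector set \<Rightarrow> ('b \<Rightarrow> 'c::real_normed_vector) \<Rightarrow> bool" where
  "Ck_on 0 S f \<longleftrightarrow> continuous_on S f"
| "Ck_on (Suc k) S f \<longleftrightarrow> (\<forall>x\<in>S. f differentiable (at x)) \<and>
      (\<forall>v. Ck_on k S (\<lambda>x. frechet_derivative f (at x) v))"

text \<open>Only used for open \<open>S\<close>.\<close>

definition smooth_on :: "'b::real_normed_vector set \<Rightarrow> ('b \<Rightarrow> 'c::real_normed_vector) \<Rightarrow> bool" where
  "smooth_on S f \<longleftrightarrow> (\<forall>k. Ck_on k S f)"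

text \<open>
  The underlying point set of the manifold is the whole type \<open>'a\<close>; its dimension is \<open>DIM('b)\<close>.
  A chart is given by its domain and its coordinate map, whose values outside the domain
  are irrelevant.
\<close>

type_synonym ('a, 'b) chart = "'a set \<times> ('a \<Rightarrow> 'b)"

definition is_chart :: "('a::topological_space, 'b::euclidean_space) chart \<Rightarrow> bool" where
  "is_chart = (\<lambda>(U, \<phi>). open U \<and> open (\<phi> ` U) \<and> (\<exists>\<psi>. homeomorphism U (\<phi> ` U) \<phi> \<psi>))"

definition smooth_atlas ::
    "('a::{t2_space, second_countable_topology}, 'b::euclidean_space) chart set \<Rightarrow> bool" where
  "smooth_atlas A \<longleftrightarrow>
     (\<forall>c\<in>A. is_chart c) \<and>
     (\<Union>(U, \<phi>)\<in>A. U) = UNIV \<and>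
     (\<forall>(U, \<phi>)\<in>A. \<forall>(V, \<psi>)\<in>A. smooth_on (\<phi> ` (U \<inter> V)) (\<psi> \<circ> inv_into U \<phi>))"

definition smooth_functions ::
    "('a::topological_space, 'b::euclidean_space) chart set \<Rightarrow> ('a \<Rightarrow> real) set" where
  "smooth_functions A = {f. \<forall>(U, \<phi>)\<in>A. smooth_on (\<phi> ` U) (f \<circ> inv_into U \<phi>)}"

section \<open>The generalized tangent bundle\<close>

text \<open>
  Tangent vectors at \<open>p\<close> are the derivations at \<open>p\<close> of the algebra of smooth functions.
  Partial functions (tangent vectors, covectors) are extended by zero outside their domains
  so that equality and the pointwise vector space operations are the intended ones.
\<close>

type_synonym 'a tvec = "('a \<Rightarrow> real) \<Rightarrow> real"
type_synonym 'a covec = "'a tvec \<Rightarrow> real"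

definition tangent_space ::
    "('a::topological_space, 'b::euclidean_space) chart set \<Rightarrow> 'a \<Rightarrow> 'a tvec set" where
  "tangent_space A p = {v.
     (\<forall>f\<in>smooth_functions A. \<forall>g\<in>smooth_functions A. \<forall>a b.
        v (\<lambda>x. a * f x + b * g x) = a * v f + b * v g) \<and>
     (\<forall>f\<in>smooth_functions A. \<forall>g\<in>smooth_functions A.
        v (\<lambda>x. f x * g x) = v f * g p + f p * v g) \<and>
     (\<forall>f. f \<notin> smooth_functions A \<longrightarrow> v f = 0)}"

definition cotangent_space ::
    "('a::topological_space, 'b::euclidean_space) chart set \<Rightarrow> 'a \<Rightarrow> 'a covec set" where
  "cotangent_space A p = {w.
     (\<forall>v\<in>tangent_space A p. \<forall>v'\<in>tangent_space A p. \<forall>a b.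
        w (\<lambda>f. a * v f + b * v' f) = a * w v + b * w v') \<and>
     (\<forall>v. v \<notin> tangent_space A p \<longrightarrow> w v = 0)}"

definition vector_fields ::
    "('a::topological_space, 'b::euclidean_space) chart set \<Rightarrow> ('a \<Rightarrow> 'a tvec) set" where
  "vector_fields A = {X. (\<forall>p. X p \<in> tangent_space A p) \<and>
     (\<forall>f\<in>smooth_functions A. (\<lambda>p. X p f) \<in> smooth_functions A)}"

definition one_forms ::
    "('a::topological_space, 'b::euclidean_space) chart set \<Rightarrow> ('a \<Rightarrow> 'a covec) set" where
  "one_forms A = {\<xi>. (\<forall>p. \<xi> p \<in> cotangent_space A p) \<and>
     (\<forall>X\<in>vector_fields A. (\<lambda>p. \<xi> p (X p)) \<in> smooth_functions A)}"

text \<open>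
  The section \<open>X + \<xi>\<close> is the pair \<open>(X, \<xi>)\<close>; in particular a vector field \<open>X\<close> is the section
  \<open>(X, 0)\<close> and a 1-form \<open>\<xi>\<close> is the section \<open>(0, \<xi>)\<close>.
  Sums, negatives and \<open>0\<close> are those of the pointwise instances for functions and pairs.
\<close>

type_synonym 'a gsection = "('a \<Rightarrow> 'a tvec) \<times> ('a \<Rightarrow> 'a covec)"
type_synonym 'a gfibre = "'a tvec \<times> 'a covec"

definition gsections ::
    "('a::topological_space, 'b::euclidean_space) chart set \<Rightarrow> 'a gsection set" where
  "gsections A = vector_fields A \<times> one_forms A"

definition gval :: "'a gsection \<Rightarrow> 'a \<Rightarrow> 'a gfibre" where
  "gval u p = (fst u p, snd u p)"

definition smul :: "('a \<Rightarrow> real) \<Rightarrow> 'a gsection \<Rightarrow> 'a gsection" where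
  "smul f u = ((\<lambda>p g. f p * fst u p g), (\<lambda>p v. f p * snd u p v))"

definition fibre_scale :: "real \<Rightarrow> 'a gfibre \<Rightarrow> 'a gfibre" where
  "fibre_scale c e = ((\<lambda>g. c * fst e g), (\<lambda>v. c * snd e v))"

lemma vector_space_fibre_scale: "vector_space fibre_scale"
  by unfold_locales (auto simp: fibre_scale_def fun_eq_iff algebra_simps prod_eq_iff)

definition fibre_dim :: "'a gfibre set \<Rightarrow> nat" where
  "fibre_dim = vector_space.dim fibre_scale"

section \<open>Generalized metrics\<close>

type_synonym 'a gform = "'a gsection \<Rightarrow> 'a gsection \<Rightarrow> 'a \<Rightarrow> real"

text \<open>
  As for any metric on a vector bundle, nondegeneracy and positive definiteness are meant
  at every point.  They are expressed through values of sections, since every element of a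
  fibre is the value of a global section.
\<close>

definition generalized_metric ::
    "('a::topological_space, 'b::euclidean_space) chart set \<Rightarrow> 'a gform \<Rightarrow> bool" where
  "generalized_metric A G \<longleftrightarrow>
     (\<forall>u\<in>gsections A. \<forall>v\<in>gsections A. G u v \<in> smooth_functions A) \<and>
     (\<forall>u\<in>gsections A. \<forall>v\<in>gsections A. \<forall>w\<in>gsections A.
        G (u + v) w = G u w + G v w \<and> G w (u + v) = G w u + G w v) \<and>
     (\<forall>f\<in>smooth_functions A. \<forall>u\<in>gsections A. \<forall>v\<in>gsections A.
        G (smul f u) v = f * G u v \<and> G u (smul f v) = f * G u v) \<and>
     (\<forall>u\<in>gsections A. \<forall>v\<in>gsections A. G u v = G v u) \<and>
     (\<forall>p. \<forall>u\<in>gsections A. (\<forall>v\<in>gsections A. G u v p = 0) \<longrightarrow> gval u p = 0)"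

definition positive_definite ::
    "('a::topological_space, 'b::euclidean_space) chart set \<Rightarrow> 'a gform \<Rightarrow> bool" where
  "positive_definite A G \<longleftrightarrow> (\<forall>p. \<forall>u\<in>gsections A. gval u p \<noteq> 0 \<longrightarrow> G u u p > 0)"

definition riemannian_metric ::
    "('a::topological_space, 'b::euclidean_space) chart set \<Rightarrow> 'a gform \<Rightarrow> bool" where
  "riemannian_metric A G \<longleftrightarrow> generalized_metric A G \<and> positive_definite A G"

definition pseudo_riemannian_metric ::
    "('a::topological_space, 'b::euclidean_space) chart set \<Rightarrow> 'a gform \<Rightarrow> bool" where
  "pseudo_riemannian_metric A G \<longleftrightarrow> generalized_metric A G \<and> \<not> positive_definite A G"

section \<open>Almost product structures\<close>

type_synonym 'a gendo = "'a gsection \<Rightarrow> 'a gsection"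

definition almost_product ::
    "('a::topological_space, 'b::euclidean_space) chart set \<Rightarrow> 'a gendo \<Rightarrow> bool" where
  "almost_product A F \<longleftrightarrow>
     (\<forall>u\<in>gsections A. F u \<in> gsections A) \<and>
     (\<forall>u\<in>gsections A. \<forall>v\<in>gsections A. F (u + v) = F u + F v) \<and>
     (\<forall>f\<in>smooth_functions A. \<forall>u\<in>gsections A. F (smul f u) = smul f (F u)) \<and>
     (\<forall>u\<in>gsections A. F (F u) = u)"

text \<open>
  The fibre at \<open>p\<close> of the eigenbundle of \<open>F\<close> for the eigenvalue \<open>\<epsilon>\<close>; the bundle map induced
  by \<open>F\<close> sends \<open>u(p)\<close> to \<open>(F u)(p)\<close>.
\<close>

definition eigen_fibre ::
    "('a::topological_space, 'b::euclidean_space) chart set \<Rightarrow> 'a gendo \<Rightarrow> real \<Rightarrow> 'a \<Rightarrow> 'a gfibre set"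
  where
  "eigen_fibre A F \<epsilon> p =
     {gval u p | u. u \<in> gsections A \<and> gval (F u) p = fibre_scale \<epsilon> (gval u p)}"

definition riemannian_almost_product ::
    "('a::topological_space, 'b::euclidean_space) chart set \<Rightarrow> 'a gendo \<Rightarrow> 'a gform \<Rightarrow> bool" where
  "riemannian_almost_product A F G \<longleftrightarrow> almost_product A F \<and> riemannian_metric A G \<and>
     (\<forall>u\<in>gsections A. \<forall>v\<in>gsections A. G (F u) (F v) = G u v)"

definition pseudo_riemannian_almost_product ::
    "('a::topological_space, 'b::euclidean_space) chart set \<Rightarrow> 'a gendo \<Rightarrow> 'a gform \<Rightarrow> bool" where
  "pseudo_riemannian_almost_product A F G \<longleftrightarrow> almost_product A F \<and> pseudo_riemannian_metric A G \<and>
     (\<forall>u\<in>gsections A. \<forall>v\<in>gsections A. G (F u) (F v) = G u v)"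

definition almost_para_norden ::
    "('a::topological_space, 'b::euclidean_space) chart set \<Rightarrow> 'a gendo \<Rightarrow> 'a gform \<Rightarrow> bool" where
  "almost_para_norden A F G \<longleftrightarrow> riemannian_almost_product A F G \<and>
     (\<forall>p. fibre_dim (eigen_fibre A F 1 p) = fibre_dim (eigen_fibre A F (-1) p))"

definition almost_para_hermitian ::
    "('a::topological_space, 'b::euclidean_space) chart set \<Rightarrow> 'a gendo \<Rightarrow> 'a gform \<Rightarrow> bool" where
  "almost_para_hermitian A F G \<longleftrightarrow> almost_product A F \<and> generalized_metric A G \<and>
     (\<forall>u\<in>gsections A. \<forall>v\<in>gsections A. G (F u) (F v) = - G u v)"

definition F0 :: "'a gendo" where
  "F0 = (\<lambda>(X, \<xi>). (- X, \<xi>))"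

end

theory Submission
  imports Defs
begin

text \<open>
  The identity \<open>F0 (X + \<xi>) = - X + \<xi>\<close> turns invariance (anti-invariance) of \<open>G\<close> into the vanishing of
  the mixed (pure) components of \<open>G\<close>, by polarisation.

  The remaining point is that the two eigenbundles of \<open>F0\<close> have the same rank when \<open>G\<close> is
  positive definite.  No coordinates are needed: \<open>G\<close> restricts to a scalar product on
  differentials, so Gram--Schmidt produces functions \<open>f\<^sub>i\<close> whose differentials are orthonormal
  at \<open>p\<close>, and the vector fields \<open>f \<mapsto> G(df\<^sub>i, df)\<close> are dual to them at \<open>p\<close>.  If the procedure
  stops, the two families are bases of the two fibres; if it did not, both fibres would be
  infinite-dimensional, and the formal dimension of both would be the junk value 0.
\<close>

section \<open>The algebra of smooth functions\<close>

text \<open>On an open set, functions that agree have the same derivative at each point, so the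
  property passes through the recursion of \<open>Ck_on\<close>. This is what allows sum and product
  formulas for \<open>frechet_derivative\<close>, known only at the points of \<open>S\<close>, to
  be substituted there.\<close>

lemma Ck_on_cong:
  assumes "open S" and "\<And>x. x \<in> S \<Longrightarrow> f x = g x" and "Ck_on k S f"
  shows "Ck_on k S g"
  using assms(2,3)
proof (induction k arbitrary: f g)
  case 0
  then show ?case
    using continuous_on_cong[of S S f g] by simp
next
  case (Suc k)
  have der: "(g has_derivative frechet_derivative f (at x)) (at x)" if "x \<in> S" for x
  proof (rule has_derivative_transform_within_open[OF _ \<open>open S\<close> that])
    show "(f has_derivative frechet_derivative f (at x)) (at x)"
      using Suc.prems(2) that by (simp add: frechet_derivative_works)
  qed (use Suc.prems(1) in auto)
  have "Ck_on k S (\<lambda>x. frechet_derivative g (at x) v)" for v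
  proof (rule Suc.IH)
    show "Ck_on k S (\<lambda>x. frechet_derivative f (at x) v)"
      using Suc.prems(2) by simp
    show "frechet_derivative f (at x) v = frechet_derivative g (at x) v" if "x \<in> S" for x
      using frechet_derivative_at[OF der[OF that]] by simp
  qed
  then show ?case
    using der by (auto simp: differentiable_def)
qed

text \<open>Differentiability at each point gives continuity at the bottom level; higher levels
  follow by applying the induction hypothesis to the directional derivatives.\<close>

lemma Ck_on_SucD:
  assumes "Ck_on (Suc k) S f"
  shows "Ck_on k S f"
  using assms
proof (induction k arbitrary: f)
  case 0
  then show ?case
    by (auto intro!: continuous_at_imp_continuous_on differentiable_imp_continuous_within)
next
  case (Suc k)
  then show ?case
    by (metis Ck_on.simps(2))
qed

lemma Ck_on_const: "Ck_on k S (\<lambda>x. c)"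
  by (induction k arbitrary: c) (auto simp: frechet_derivative_const)

lemma Ck_on_add:
  assumes "open S" and "Ck_on k S f" and "Ck_on k S g"
  shows "Ck_on k S (\<lambda>x. f x + g x)"
  using assms(2,3)
proof (induction k arbitrary: f g)
  case 0
  then show ?case by (auto intro: continuous_intros)
next
  case (Suc k)
  have "Ck_on k S (\<lambda>x. frechet_derivative (\<lambda>x. f x + g x) (at x) v)" for v
  proof (rule Ck_on_cong[OF \<open>open S\<close>])
    show "Ck_on k S (\<lambda>x. frechet_derivative f (at x) v + frechet_derivative g (at x) v)"
      using Suc by simp
    show "frechet_derivative f (at x) v + frechet_derivative g (at x) v
        = frechet_derivative (\<lambda>x. f x + g x) (at x) v" if "x \<in> S" for x
    proof -
      have "((\<lambda>x. f x + g x) has_derivative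
          (\<lambda>v. frechet_derivative f (at x) v + frechet_derivative g (at x) v)) (at x)"
        using Suc.prems that by (auto intro!: has_derivative_add simp: frechet_derivative_works[symmetric])
      from frechet_derivative_at[OF this] show ?thesis by metis
    qed
  qed
  then show ?case
    using Suc.prems by simp
qed

text \<open>By the Leibniz rule each derivative is a sum of products in which one factor is
  undifferentiated. That factor is used at order \<open>k\<close> only, which
  \<open>Ck_on_SucD\<close> provides.\<close>

lemma Ck_on_mult:
  fixes f g :: "'b::real_normed_vector \<Rightarrow> real"
  assumes "open S" and "Ck_on k S f" and "Ck_on k S g"
  shows "Ck_on k S (\<lambda>x. f x * g x)"
  using assms(2,3)
proof (induction k arbitrary: f g)
  case 0
  then show ?case by (auto intro: continuous_intros)
next
  case (Suc k)
  have "Ck_on k S (\<lambda>x. frechet_derivative (\<lambda>x. f x * g x) (at x) v)" for v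
  proof (rule Ck_on_cong[OF \<open>open S\<close>])
    show "Ck_on k S (\<lambda>x. f x * frechet_derivative g (at x) v + frechet_derivative f (at x) v * g x)"
      using Suc.prems Ck_on_SucD[OF Suc.prems(1)] Ck_on_SucD[OF Suc.prems(2)]
      by (intro Ck_on_add[OF \<open>open S\<close>] Suc.IH) auto
    show "f x * frechet_derivative g (at x) v + frechet_derivative f (at x) v * g x
        = frechet_derivative (\<lambda>x. f x * g x) (at x) v" if "x \<in> S" for x
    proof -
      have "((\<lambda>x. f x * g x) has_derivative
          (\<lambda>v. f x * frechet_derivative g (at x) v + frechet_derivative f (at x) v * g x)) (at x)"
        using Suc.prems that by (auto intro!: has_derivative_mult simp: frechet_derivative_works[symmetric])
      from frechet_derivative_at[OF this] show ?thesis by metis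
    qed
  qed
  then show ?case
    using Suc.prems by simp
qed

section \<open>Smooth functions on the manifold, chart by chart\<close>

lemma smooth_functions_const: "(\<lambda>x. c) \<in> smooth_functions A"
  by (auto simp: smooth_functions_def smooth_on_def comp_def Ck_on_const)

lemma smooth_atlas_open_image: "smooth_atlas A \<Longrightarrow> (U, \<phi>) \<in> A \<Longrightarrow> open (\<phi> ` U)"
  by (auto simp: smooth_atlas_def is_chart_def)

lemma smooth_functions_add:
  assumes "smooth_atlas A" and "f \<in> smooth_functions A" and "g \<in> smooth_functions A"
  shows "(\<lambda>x. f x + g x) \<in> smooth_functions A"
  using assms smooth_atlas_open_image[OF assms(1)]
  by (auto simp: smooth_functions_def smooth_on_def comp_def intro!: Ck_on_add)

lemma smooth_functions_mult:
  assumes "smooth_atlas A" and "f \<in> smooth_functions A" and "g \<in> smooth_functions A"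
  shows "(\<lambda>x. f x * g x) \<in> smooth_functions A"
  using assms smooth_atlas_open_image[OF assms(1)]
  by (auto simp: smooth_functions_def smooth_on_def comp_def intro!: Ck_on_mult)

lemma smooth_functions_lincomb:
  assumes "smooth_atlas A" and "f \<in> smooth_functions A" and "g \<in> smooth_functions A"
  shows "(\<lambda>x. a * f x + b * g x) \<in> smooth_functions A"
  using assms by (intro smooth_functions_add smooth_functions_mult smooth_functions_const)

lemma smooth_functions_sum:
  fixes n :: nat
  assumes "smooth_atlas A" and "\<And>i. i < n \<Longrightarrow> f i \<in> smooth_functions A"
  shows "(\<lambda>x. \<Sum>i<n. c i * f i x) \<in> smooth_functions A"
  using assms(2)
proof (induction n)
  case 0
  then show ?case by (simp add: smooth_functions_const)
next
  case (Suc n)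
  then show ?case
    using smooth_functions_lincomb[OF assms(1), of "\<lambda>x. \<Sum>i<n. c i * f i x" "f n" 1 "c n"] by simp
qed

section \<open>Vector fields and 1-forms\<close>

lemma tangent_space_lincomb:
  assumes "v \<in> tangent_space A p" and "w \<in> tangent_space A p"
  shows "(\<lambda>f. a * v f + b * w f) \<in> tangent_space A p"
  using assms by (auto simp: tangent_space_def algebra_simps)

lemma cotangent_space_lincomb:
  assumes "v \<in> cotangent_space A p" and "w \<in> cotangent_space A p"
  shows "(\<lambda>f. a * v f + b * w f) \<in> cotangent_space A p"
  using assms by (auto simp: cotangent_space_def algebra_simps)

lemma tangent_vector_lincomb:
  assumes "v \<in> tangent_space A p" and "f \<in> smooth_functions A" and "g \<in> smooth_functions A"
  shows "v (\<lambda>x. a * f x + b * g x) = a * v f + b * v g"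
  using assms by (auto simp: tangent_space_def)

lemma covector_lincomb:
  assumes "w \<in> cotangent_space A p" and "v \<in> tangent_space A p" and "v' \<in> tangent_space A p"
  shows "w (\<lambda>f. a * v f + b * v' f) = a * w v + b * w v'"
  using assms by (auto simp: cotangent_space_def)

lemma zero_tangent_space: "(\<lambda>f. 0) \<in> tangent_space A p"
  by (auto simp: tangent_space_def)

lemma tangent_vector_sum:
  fixes n :: nat
  assumes "smooth_atlas A" and "v \<in> tangent_space A p" and "\<And>i. i < n \<Longrightarrow> f i \<in> smooth_functions A"
  shows "v (\<lambda>x. \<Sum>i<n. c i * f i x) = (\<Sum>i<n. c i * v (f i))"
  using assms(3)
proof (induction n)
  case 0
  \<comment> \<open>Linearity is given for binary combinations, so \<open>v 0 = 0\<close> is read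
    off from the combination with both coefficients 0.\<close>
  then show ?case
    using tangent_vector_lincomb[OF assms(2), of "\<lambda>x. 0" "\<lambda>x. 0" 0 0]
    by (simp add: smooth_functions_const)
next
  case (Suc n)
  have "(\<lambda>x. \<Sum>i<n. c i * f i x) \<in> smooth_functions A"
    using Suc.prems by (intro smooth_functions_sum[OF assms(1)]) auto
  then show ?case
    using Suc tangent_vector_lincomb[OF assms(2), of "\<lambda>x. \<Sum>i<n. c i * f i x" "f n" 1 "c n"] by simp
qed

text \<open>A covector is linear on tangent vectors only. The induction therefore has to carry along
  that the partial sums are tangent vectors.\<close>

lemma covector_sum:
  fixes n :: nat
  assumes "w \<in> cotangent_space A p" and "\<And>i. i < n \<Longrightarrow> v i \<in> tangent_space A p"
  shows "(\<lambda>f. \<Sum>i<n. c i * v i f) \<in> tangent_space A p \<and>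
    w (\<lambda>f. \<Sum>i<n. c i * v i f) = (\<Sum>i<n. c i * w (v i))"
  using assms(2)
proof (induction n)
  case 0
  show ?case
    using covector_lincomb[OF assms(1) zero_tangent_space zero_tangent_space, of 0 0]
    by (simp add: zero_tangent_space)
next
  case (Suc n)
  let ?s = "\<lambda>f. \<Sum>i<n. c i * v i f"
  have s: "?s \<in> tangent_space A p" "w ?s = (\<Sum>i<n. c i * w (v i))" and vn: "v n \<in> tangent_space A p"
    using Suc by auto
  have "w (\<lambda>f. 1 * ?s f + c n * v n f) = 1 * w ?s + c n * w (v n)"
    by (rule covector_lincomb[OF assms(1) s(1) vn])
  then show ?case
    using s(2) tangent_space_lincomb[OF s(1) vn, of 1 "c n"] by simp
qed

lemma vector_fields_lincomb:
  assumes "smooth_atlas A" and "f \<in> smooth_functions A" and "g \<in> smooth_functions A"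
    and "X \<in> vector_fields A" and "Y \<in> vector_fields A"
  shows "(\<lambda>p h. f p * X p h + g p * Y p h) \<in> vector_fields A"
  using assms by (auto simp: vector_fields_def
      intro!: tangent_space_lincomb smooth_functions_add smooth_functions_mult)

lemma one_forms_lincomb:
  assumes "smooth_atlas A" and "f \<in> smooth_functions A" and "g \<in> smooth_functions A"
    and "\<xi> \<in> one_forms A" and "\<eta> \<in> one_forms A"
  shows "(\<lambda>p v. f p * \<xi> p v + g p * \<eta> p v) \<in> one_forms A"
  using assms by (auto simp: one_forms_def
      intro!: cotangent_space_lincomb smooth_functions_add smooth_functions_mult)

lemma zero_vector_fields: "0 \<in> vector_fields A"
  by (auto simp: vector_fields_def zero_fun_def zero_tangent_space smooth_functions_const)

lemma zero_one_forms: "0 \<in> one_forms A"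
  by (auto simp: one_forms_def zero_fun_def cotangent_space_def smooth_functions_const)

lemma uminus_vector_fields: "smooth_atlas A \<Longrightarrow> X \<in> vector_fields A \<Longrightarrow> - X \<in> vector_fields A"
  using vector_fields_lincomb[of A "\<lambda>x. -1" "\<lambda>x. 0" X X]
  by (simp add: smooth_functions_const fun_Compl_def)

section \<open>Differentials and their metric duals\<close>

text \<open>The value 0 off the tangent space follows the convention built into
  \<open>cotangent_space\<close>.\<close>

definition differential ::
    "('a::topological_space, 'b::euclidean_space) chart set \<Rightarrow> ('a \<Rightarrow> real) \<Rightarrow> 'a \<Rightarrow> 'a covec" where
  "differential A f p v = (if v \<in> tangent_space A p then v f else 0)"

lemma differential_one_forms:
  assumes "f \<in> smooth_functions A"
  shows "differential A f \<in> one_forms A"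
  using assms by (auto simp: one_forms_def cotangent_space_def differential_def vector_fields_def
      tangent_space_lincomb)

lemma differential_gsections:
  "f \<in> smooth_functions A \<Longrightarrow> (0, differential A f) \<in> gsections A"
  by (simp add: gsections_def zero_vector_fields differential_one_forms)

text \<open>The restriction of \<open>G\<close> to 1-forms induces a map from 1-forms to vector
  fields; this is the image of \<open>\<xi>\<close>, acting on functions by
  \<open>f \<mapsto> G(\<xi>, df)\<close>. For exact \<open>\<xi>\<close> it is a gradient. The
  value 0 off the smooth functions follows the convention of \<open>tangent_space\<close>.\<close>

definition metric_dual ::
    "('a::topological_space, 'b::euclidean_space) chart set \<Rightarrow> 'a gform \<Rightarrow> ('a \<Rightarrow> 'a covec) \<Rightarrow> 'a \<Rightarrow> 'a tvec" where
  "metric_dual A G \<xi> p f = (if f \<in> smooth_functions A then G (0, \<xi>) (0, differential A f) p else 0)"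

text \<open>Coefficients are functions rather than constants so that the lemma covers
  \<open>d(fg) = g df + f dg\<close>.\<close>

lemma generalized_metric_lincomb:
  assumes "smooth_atlas A" and "generalized_metric A G"
    and "f \<in> smooth_functions A" and "g \<in> smooth_functions A"
    and "w \<in> gsections A" and "\<xi> \<in> one_forms A" and "\<eta> \<in> one_forms A"
  shows "G w (0, \<lambda>p v. f p * \<xi> p v + g p * \<eta> p v) p = f p * G w (0, \<xi>) p + g p * G w (0, \<eta>) p"
proof -
  have sec: "(0, \<xi>) \<in> gsections A" "(0, \<eta>) \<in> gsections A"
    using assms by (auto simp: gsections_def zero_vector_fields)
  have scaled: "smul h (0, \<zeta>) \<in> gsections A"
    if "h \<in> smooth_functions A" "\<zeta> \<in> one_forms A" for h \<zeta>
    using one_forms_lincomb[OF assms(1) that(1) smooth_functions_const[of 0] that(2) that(2)]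
      zero_vector_fields[of A]
    by (simp add: gsections_def smul_def zero_fun_def)
  have "(0, \<lambda>p v. f p * \<xi> p v + g p * \<eta> p v) = smul f (0, \<xi>) + smul g (0, \<eta>)"
    by (simp add: smul_def fun_eq_iff)
  then have "G w (0, \<lambda>p v. f p * \<xi> p v + g p * \<eta> p v) = G w (smul f (0, \<xi>)) + G w (smul g (0, \<eta>))"
    using assms(2,5) scaled[OF assms(3,6)] scaled[OF assms(4,7)]
    by (simp add: generalized_metric_def)
  also have "\<dots> = f * G w (0, \<xi>) + g * G w (0, \<eta>)"
    using assms(2-5) sec by (simp add: generalized_metric_def)
  finally show ?thesis by simp
qed

text \<open>The differential is linear and satisfies the Leibniz rule, and \<open>G\<close> is
  linear over smooth functions in its second argument; so the value at \<open>p\<close> is a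
  derivation. Smoothness is that of \<open>G\<close> on sections.\<close>

lemma metric_dual_vector_fields:
  assumes "smooth_atlas A" and "generalized_metric A G" and "\<xi> \<in> one_forms A"
  shows "metric_dual A G \<xi> \<in> vector_fields A"
proof -
  have sec: "(0, \<xi>) \<in> gsections A"
    using assms by (simp add: gsections_def zero_vector_fields)
  have "metric_dual A G \<xi> p \<in> tangent_space A p" for p
  proof -
    have "metric_dual A G \<xi> p (\<lambda>x. a * f x + b * g x)
        = a * metric_dual A G \<xi> p f + b * metric_dual A G \<xi> p g"
      if fg: "f \<in> smooth_functions A" "g \<in> smooth_functions A" for f g a b
    proof -
      have "differential A (\<lambda>x. a * f x + b * g x)
          = (\<lambda>p v. a * differential A f p v + b * differential A g p v)"
        using fg by (auto simp: differential_def fun_eq_iff tangent_vector_lincomb)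
      then show ?thesis
        using generalized_metric_lincomb[OF assms(1,2) smooth_functions_const[of a]
            smooth_functions_const[of b] sec differential_one_forms differential_one_forms] fg
        by (simp add: metric_dual_def smooth_functions_lincomb[OF assms(1)])
    qed
    moreover have "metric_dual A G \<xi> p (\<lambda>x. f x * g x)
        = metric_dual A G \<xi> p f * g p + f p * metric_dual A G \<xi> p g"
      if fg: "f \<in> smooth_functions A" "g \<in> smooth_functions A" for f g
    proof -
      have "differential A (\<lambda>x. f x * g x)
          = (\<lambda>p v. g p * differential A f p v + f p * differential A g p v)"
        using fg by (auto simp: differential_def fun_eq_iff tangent_space_def)
      then show ?thesis
        using generalized_metric_lincomb[OF assms(1,2) fg(2) fg(1) sec
            differential_one_forms differential_one_forms] fg
        by (simp add: metric_dual_def smooth_functions_mult[OF assms(1)])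
    qed
    ultimately show ?thesis
      by (auto simp: tangent_space_def metric_dual_def)
  qed
  moreover have "(\<lambda>p. metric_dual A G \<xi> p f) \<in> smooth_functions A" if "f \<in> smooth_functions A" for f
    using that assms(2) sec differential_gsections[OF that]
    by (simp add: metric_dual_def generalized_metric_def)
  ultimately show ?thesis
    by (simp add: vector_fields_def)
qed

text \<open>Symmetry here and positivity in \<open>metric_dual_pos\<close> are the scalar product
  properties that Gram--Schmidt uses on differentials at \<open>p\<close>.\<close>

lemma metric_dual_sym:
  assumes "generalized_metric A G" and "f \<in> smooth_functions A" and "g \<in> smooth_functions A"
  shows "metric_dual A G (differential A f) p g = metric_dual A G (differential A g) p f"
  using assms by (simp add: metric_dual_def generalized_metric_def differential_gsections)

lemma metric_dual_pos:
  assumes "positive_definite A G" and "f \<in> smooth_functions A" and "differential A f p \<noteq> 0"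
  shows "metric_dual A G (differential A f) p f > 0"
  using assms differential_gsections[OF assms(2)]
  by (auto simp: metric_dual_def positive_definite_def gval_def prod_eq_iff)

section \<open>Orthonormal differentials\<close>

text \<open>The Kronecker condition has two readings: the \<open>df_i\<close> are orthonormal for
  \<open>G\<close> at \<open>p\<close>, and the metric duals of the \<open>df_i\<close> are dual to
  the \<open>df_j\<close> at \<open>p\<close>.\<close>

definition orthonormal_differentials ::
    "('a::topological_space, 'b::euclidean_space) chart set \<Rightarrow> 'a gform \<Rightarrow> 'a \<Rightarrow> nat \<Rightarrow> (nat \<Rightarrow> 'a \<Rightarrow> real) \<Rightarrow> bool" where
  "orthonormal_differentials A G p n f \<longleftrightarrow>
     (\<forall>i<n. f i \<in> smooth_functions A) \<and>
     (\<forall>i<n. \<forall>j<n. metric_dual A G (differential A (f i)) p (f j) = (if i = j then 1 else 0))"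

text \<open>One Gram--Schmidt step. The sum in \<open>not_span\<close> is the orthogonal projection
  of \<open>dh\<close> to the span of the \<open>df_i\<close> at \<open>p\<close>, so the hypothesis
  says that a nonzero remainder is left to normalise.\<close>

lemma orthonormal_differentials_extend:
  assumes "smooth_atlas A" and "riemannian_metric A G"
    and orth: "orthonormal_differentials A G p n f" and h: "h \<in> smooth_functions A"
    and not_span: "differential A h p \<noteq>
      (\<lambda>v. \<Sum>i<n. metric_dual A G (differential A (f i)) p h * differential A (f i) p v)"
  shows "\<exists>f'. orthonormal_differentials A G p (Suc n) f'"
proof -
  have gm: "generalized_metric A G" and pd: "positive_definite A G"
    using assms(2) by (auto simp: riemannian_metric_def)
  define X where "X k = metric_dual A G (differential A k) p" for k
  have X: "X k \<in> tangent_space A p" if "k \<in> smooth_functions A" for k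
    using metric_dual_vector_fields[OF assms(1) gm differential_one_forms[OF that]]
    by (simp add: X_def vector_fields_def)
  have sym: "X k l = X l k" if "k \<in> smooth_functions A" "l \<in> smooth_functions A" for k l
    using metric_dual_sym[OF gm that] by (simp add: X_def)
  have f: "f i \<in> smooth_functions A" if "i < n" for i
    using orth that by (simp add: orthonormal_differentials_def)
  have Xf: "X (f i) (f j) = (if i = j then 1 else 0)" if "i < n" "j < n" for i j
    using orth that by (simp add: orthonormal_differentials_def X_def)
  \<comment> \<open>The coefficients are the real numbers obtained at \<open>p\<close>, so
    \<open>s\<close> is a globally smooth function whose differential at \<open>p\<close> is the
    projection of \<open>dh\<close>.\<close>
  define s where "s = (\<lambda>x. \<Sum>i<n. X (f i) h * f i x)"
  have s: "s \<in> smooth_functions A"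
    unfolding s_def using f by (rule smooth_functions_sum[OF assms(1)])
  define g where "g = (\<lambda>x. 1 * h x + (-1) * s x)"
  have g: "g \<in> smooth_functions A"
    unfolding g_def by (rule smooth_functions_lincomb[OF assms(1) h s])
  have vg: "v g = v h - (\<Sum>i<n. X (f i) h * v (f i))" if "v \<in> tangent_space A p" for v
  proof -
    have "v s = (\<Sum>i<n. X (f i) h * v (f i))"
      unfolding s_def using f by (rule tangent_vector_sum[OF assms(1) that])
    then show ?thesis
      using tangent_vector_lincomb[OF that h s, of 1 "-1"] by (simp add: g_def)
  qed
  have "differential A g p \<noteq> 0"
  proof
    assume "differential A g p = 0"
    then have zero: "v g = 0" if "v \<in> tangent_space A p" for v
      using that by (auto simp: differential_def fun_eq_iff split: if_splits)
    have "v h = (\<Sum>i<n. X (f i) h * v (f i))" if "v \<in> tangent_space A p" for v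
      using vg[OF that] zero[OF that] by linarith
    then have "differential A h p v = (\<Sum>i<n. X (f i) h * differential A (f i) p v)" for v
      by (auto simp: differential_def)
    then show False
      using not_span by (auto simp: X_def)
  qed
  then have pos: "X g g > 0"
    using metric_dual_pos[OF pd g] by (simp add: X_def)
  have Xfg: "X (f j) g = 0" if "j < n" for j
  proof -
    have "(\<Sum>i<n. X (f i) h * X (f j) (f i)) = (\<Sum>i<n. if i = j then X (f j) h else 0)"
      using that by (intro sum.cong) (auto simp: Xf)
    also have "\<dots> = X (f j) h"
      using that by simp
    finally show ?thesis
      using vg[OF X[OF f[OF that]]] by simp
  qed
  define c where "c = 1 / sqrt (X g g)"
  have c: "c * (c * X g g) = 1"
    using pos by (simp add: c_def)
  \<comment> \<open>The summand \<open>0 * g x\<close> puts the rescaling into the shape of a binary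
    linear combination.\<close>
  define e where "e = (\<lambda>x. c * g x + 0 * g x)"
  have e: "e \<in> smooth_functions A"
    unfolding e_def by (rule smooth_functions_lincomb[OF assms(1) g g])
  have ve: "v e = c * v g" if "v \<in> tangent_space A p" for v
    using tangent_vector_lincomb[OF that g g, of c 0] by (simp add: e_def)
  have Xfe: "X (f j) e = 0" if "j < n" for j
    using ve[OF X[OF f[OF that]]] Xfg[OF that] by simp
  \<comment> \<open>Only the function argument of \<open>X\<close> is known to be linear. Symmetry
    brings the other \<open>e\<close> there:
    \<open>X e e = c * X e g = c * X g e = c * (c * X g g)\<close>.\<close>
  have "X e e = 1"
    using ve[OF X[OF e]] sym[OF e g] ve[OF X[OF g]] c by simp
  moreover have "X e (f j) = 0" if "j < n" for j
    using Xfe[OF that] sym[OF e f[OF that]] by simp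
  ultimately have "orthonormal_differentials A G p (Suc n) (f(n := e))"
    using f e Xf Xfe by (auto simp: orthonormal_differentials_def X_def less_Suc_eq)
  then show ?thesis by blast
qed

section \<open>Ranks of the eigenbundles\<close>

text \<open>Applying \<open>l j\<close> to a vanishing combination isolates the coefficient of
  \<open>x j\<close>. The same functionals separate the vectors, so the family is injective and its
  image has \<open>n\<close> elements.\<close>

lemma (in vector_space) independent_biorthogonal:
  fixes x :: "nat \<Rightarrow> 'b" and l :: "nat \<Rightarrow> 'b \<Rightarrow> 'a"
  assumes "\<And>j. j < n \<Longrightarrow> module_hom scale (*) (l j)"
    and "\<And>i j. i < n \<Longrightarrow> j < n \<Longrightarrow> l j (x i) = (if i = j then 1 else 0)"
  shows "independent (x ` {..<n})" and "card (x ` {..<n}) = n"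
proof -
  have inj: "inj_on x {..<n}"
    by (rule inj_onI) (metis assms(2) lessThan_iff zero_neq_one)
  then show "card (x ` {..<n}) = n"
    by (simp add: card_image)
  show "independent (x ` {..<n})"
  proof (rule independent_if_scalars_zero)
    fix u y
    assume sum0: "(\<Sum>y\<in>x ` {..<n}. u y *s y) = 0" and "y \<in> x ` {..<n}"
    then obtain j where j: "j < n" "y = x j" by auto
    interpret l: module_hom scale "(*)" "l j"
      by (rule assms(1)[OF j(1)])
    have "0 = l j (\<Sum>i<n. u (x i) *s x i)"
      using sum0 by (simp add: sum.reindex[OF inj] l.zero)
    also have "\<dots> = (\<Sum>i<n. if i = j then u (x j) else 0)"
      unfolding l.sum l.scale using assms(2) j(1) by (intro sum.cong) auto
    finally show "u y = 0"
      using j by simp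
  qed simp
qed

text \<open>A finite basis of the span would bound the size of independent subsets of
  \<open>E\<close>. Every basis is thus infinite, and \<open>card\<close> of an infinite set is
  0.\<close>

lemma (in vector_space) dim_zero_if_unbounded:
  assumes "\<And>n. \<exists>B\<subseteq>E. independent B \<and> card B = n"
  shows "dim E = 0"
proof -
  have "card b = 0" if b: "independent b" "span b = span E" for b
  proof (rule ccontr)
    assume "card b \<noteq> 0"
    then have fin: "finite b" by (meson card.infinite)
    obtain B where B: "B \<subseteq> E" "independent B" "card B = Suc (card b)"
      using assms by blast
    have "B \<subseteq> span b"
      using B(1) b(2) span_superset by blast
    from independent_span_bound[OF fin B(2) this] B(3) show False by simp
  qed
  then show ?thesis
    unfolding dim_def by (smt (verit, best) someI_ex)
qed

section \<open>The eigenbundles of \<open>F0\<close> fibrewise\<close>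

interpretation fibre: vector_space fibre_scale
  by (rule vector_space_fibre_scale)

lemma fibre_sum:
  fixes e :: "nat \<Rightarrow> 'a gfibre"
  shows "(\<Sum>i<n. fibre_scale (c i) (e i))
    = ((\<lambda>f. \<Sum>i<n. c i * fst (e i) f), (\<lambda>v. \<Sum>i<n. c i * snd (e i) v))"
  by (induction n) (auto simp: fibre_scale_def zero_prod_def zero_fun_def plus_prod_def fun_eq_iff)

text \<open>The eigenvalue equation at \<open>p\<close> forces the vector part to vanish at
  \<open>p\<close>, though possibly not elsewhere. Replacing that part by the zero field leaves the
  value at \<open>p\<close> unchanged.\<close>

lemma eigen_fibre_F0_plus:
  "eigen_fibre A F0 1 p = {(0, \<xi> p) | \<xi>. \<xi> \<in> one_forms A}"
proof -
  have "- X p = X p \<longleftrightarrow> X p = 0" for X :: "'a \<Rightarrow> 'a tvec"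
    by (auto simp: fun_eq_iff)
  then show ?thesis
    using zero_vector_fields[of A]
    by (fastforce simp: eigen_fibre_def gsections_def gval_def F0_def fibre_scale_def)
qed

lemma eigen_fibre_F0_minus:
  "eigen_fibre A F0 (-1) p = {(X p, 0) | X. X \<in> vector_fields A}"
proof -
  have "\<xi> p = (\<lambda>v. - \<xi> p v) \<longleftrightarrow> \<xi> p = 0" for \<xi> :: "'a \<Rightarrow> 'a covec"
    by (auto simp: fun_eq_iff)
  then show ?thesis
    using zero_one_forms[of A]
    by (fastforce simp: eigen_fibre_def gsections_def gval_def F0_def fibre_scale_def fun_Compl_def)
qed

text \<open>\<open>G\<close> does not occur in the conclusion: it serves to produce independent
  families of equal size in the two fibres.\<close>

lemma fibre_dim_eigen_fibre_F0:
  assumes "smooth_atlas A" and "riemannian_metric A G"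
  shows "fibre_dim (eigen_fibre A F0 1 p) = fibre_dim (eigen_fibre A F0 (-1) p)"
proof -
  let ?P = "eigen_fibre A F0 1 p" and ?M = "eigen_fibre A F0 (-1) p"
  have gm: "generalized_metric A G"
    using assms(2) by (simp add: riemannian_metric_def)
  define X where "X k = metric_dual A G (differential A k)" for k
  have X: "X k \<in> vector_fields A" if "k \<in> smooth_functions A" for k
    using metric_dual_vector_fields[OF assms(1) gm differential_one_forms[OF that]]
    by (simp add: X_def)
  then have XT: "X k p \<in> tangent_space A p" if "k \<in> smooth_functions A" for k
    using that by (simp add: vector_fields_def)
  define x where "x f i = (X (f i) p, 0 :: 'a covec)" for f :: "nat \<Rightarrow> 'a \<Rightarrow> real" and i
  define y where "y f i = (0 :: 'a tvec, differential A (f i) p)" for f :: "nat \<Rightarrow> 'a \<Rightarrow> real" and i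
  have hom: "module_hom fibre_scale (*) (\<lambda>e. fst e k)" "module_hom fibre_scale (*) (\<lambda>e. snd e v)"
    for k :: "'a \<Rightarrow> real" and v :: "'a tvec"
    by unfold_locales (auto simp: fibre_scale_def algebra_simps)
  have indep: "fibre.independent (x f ` {..<n})" "card (x f ` {..<n}) = n" "x f ` {..<n} \<subseteq> ?M"
    "fibre.independent (y f ` {..<n})" "card (y f ` {..<n}) = n" "y f ` {..<n} \<subseteq> ?P"
    if orth: "orthonormal_differentials A G p n f" for n f
  proof -
    have f: "f i \<in> smooth_functions A" if "i < n" for i
      using orth that by (simp add: orthonormal_differentials_def)
    have Xf: "X (f i) p (f j) = (if i = j then 1 else 0)" if "i < n" "j < n" for i j
      using orth that by (simp add: orthonormal_differentials_def X_def)
    \<comment> \<open>The dual functionals are evaluation at the functions \<open>f j\<close> for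
      the family \<open>x\<close>, and evaluation at the tangent vectors \<open>X (f j) p\<close>
      for the family \<open>y\<close>.\<close>
    show "fibre.independent (x f ` {..<n})" "card (x f ` {..<n}) = n"
      using fibre.independent_biorthogonal[of n "\<lambda>j e. fst e (f j)" "x f"] hom(1) Xf
      by (auto simp: x_def)
    show "fibre.independent (y f ` {..<n})" "card (y f ` {..<n}) = n"
      using fibre.independent_biorthogonal[of n "\<lambda>j e. snd e (X (f j) p)" "y f"] hom(2) Xf XT f
      by (auto simp: y_def differential_def)
    show "x f ` {..<n} \<subseteq> ?M"
      using X f by (auto simp: eigen_fibre_F0_minus x_def)
    show "y f ` {..<n} \<subseteq> ?P"
      using differential_one_forms f by (auto simp: eigen_fibre_F0_plus y_def)
  qed
  show ?thesis
  proof (cases "\<forall>n. \<exists>f. orthonormal_differentials A G p n f")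
    case True
    have "fibre.dim ?P = 0"
      by (rule fibre.dim_zero_if_unbounded) (meson True indep)
    moreover have "fibre.dim ?M = 0"
      by (rule fibre.dim_zero_if_unbounded) (meson True indep)
    ultimately show ?thesis
      by (simp add: fibre_dim_def)
  next
    case False
    \<comment> \<open>The empty family is orthonormal, so if some length does not occur, induction
      yields a length \<open>n\<close> that occurs while \<open>Suc n\<close> does not.\<close>
    have "\<exists>f. orthonormal_differentials A G p 0 f"
      by (simp add: orthonormal_differentials_def)
    with False obtain n f where orth: "orthonormal_differentials A G p n f"
      and maximal: "\<nexists>f'. orthonormal_differentials A G p (Suc n) f'"
      using nat_induct[of "\<lambda>n. \<exists>f. orthonormal_differentials A G p n f"] by blast
    have f: "f i \<in> smooth_functions A" if "i < n" for i
      using orth that by (simp add: orthonormal_differentials_def)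
    \<comment> \<open>By maximality no differential leaves a remainder at \<open>p\<close>.\<close>
    have dh: "differential A h p = (\<lambda>v. \<Sum>i<n. X (f i) p h * differential A (f i) p v)"
      if "h \<in> smooth_functions A" for h
      using orthonormal_differentials_extend[OF assms orth that] maximal by (auto simp: X_def)
    \<comment> \<open>Evaluating the expansion of \<open>dh\<close> on \<open>v\<close> exchanges
      the roles: \<open>v h = dh(v)\<close> becomes a combination of the \<open>X (f i) p h\<close>.
      Hence all tangent vectors at \<open>p\<close>, not just gradients, are spanned. Off the smooth
      functions both sides are 0.\<close>
    have v_eq: "v = (\<lambda>h. \<Sum>i<n. v (f i) * X (f i) p h)" if v: "v \<in> tangent_space A p" for v
    proof
      fix h
      show "v h = (\<Sum>i<n. v (f i) * X (f i) p h)"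
      proof (cases "h \<in> smooth_functions A")
        case True
        then show ?thesis
          using fun_cong[OF dh[OF True], of v] v by (simp add: differential_def mult.commute)
      next
        case False
        then show ?thesis
          using v by (simp add: X_def metric_dual_def tangent_space_def)
      qed
    qed
    have "?M \<subseteq> fibre.span (x f ` {..<n})"
    proof
      fix e assume "e \<in> ?M"
      then obtain Y where Y: "Y \<in> vector_fields A" "e = (Y p, 0)"
        by (auto simp: eigen_fibre_F0_minus)
      then have "Y p \<in> tangent_space A p"
        by (simp add: vector_fields_def)
      then have "e = ((\<lambda>h. \<Sum>i<n. Y p (f i) * X (f i) p h), 0)"
        unfolding Y(2) by (rule arg_cong[where f = "\<lambda>v. (v, 0)", OF v_eq])
      also have "\<dots> = (\<Sum>i<n. fibre_scale (Y p (f i)) (x f i))"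
        by (simp add: fibre_sum x_def zero_fun_def)
      finally have "e = (\<Sum>i<n. fibre_scale (Y p (f i)) (x f i))" .
      then show "e \<in> fibre.span (x f ` {..<n})"
        by (auto intro!: fibre.span_sum fibre.span_scale intro: fibre.span_base)
    qed
    then have "fibre.dim ?M = n"
      using indep[OF orth] by (intro fibre.dim_unique[of "x f ` {..<n}"]) auto
    moreover have "?P \<subseteq> fibre.span (y f ` {..<n})"
    proof
      fix e assume "e \<in> ?P"
      then obtain \<xi> where \<xi>: "\<xi> \<in> one_forms A" "e = (0, \<xi> p)"
        by (auto simp: eigen_fibre_F0_plus)
      then have cot: "\<xi> p \<in> cotangent_space A p"
        by (simp add: one_forms_def)
      \<comment> \<open>The covector is expanded through its argument, by applying it to the
        expansion \<open>v_eq\<close> of \<open>v\<close>; off the tangent space both sides are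
        0.\<close>
      have "\<xi> p v = (\<Sum>i<n. \<xi> p (X (f i) p) * differential A (f i) p v)" for v
      proof (cases "v \<in> tangent_space A p")
        case True
        have "\<xi> p v = \<xi> p (\<lambda>h. \<Sum>i<n. v (f i) * X (f i) p h)"
          by (rule arg_cong[OF v_eq[OF True]])
        also have "\<dots> = (\<Sum>i<n. v (f i) * \<xi> p (X (f i) p))"
          using covector_sum[OF cot, of n "\<lambda>i. X (f i) p" "\<lambda>i. v (f i)"] XT f by simp
        finally show ?thesis
          using True by (simp add: differential_def mult.commute)
      next
        case False
        then show ?thesis
          using cot by (simp add: cotangent_space_def differential_def)
      qed
      then have "e = (0, \<lambda>v. \<Sum>i<n. \<xi> p (X (f i) p) * differential A (f i) p v)"
        unfolding \<xi>(2) by (intro arg_cong[where f = "Pair 0"] ext)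
      also have "\<dots> = (\<Sum>i<n. fibre_scale (\<xi> p (X (f i) p)) (y f i))"
        by (simp add: fibre_sum y_def zero_fun_def)
      finally have "e = (\<Sum>i<n. fibre_scale (\<xi> p (X (f i) p)) (y f i))" .
      then show "e \<in> fibre.span (y f ` {..<n})"
        by (auto intro!: fibre.span_sum fibre.span_scale intro: fibre.span_base)
    qed
    then have "fibre.dim ?P = n"
      using indep[OF orth] by (intro fibre.dim_unique[of "y f ` {..<n}"]) auto
    ultimately show ?thesis
      by (simp add: fibre_dim_def)
  qed
qed

section \<open>Invariance under the natural paracomplex structure\<close>

lemma almost_product_F0:
  assumes "smooth_atlas A"
  shows "almost_product A F0"
  using uminus_vector_fields[OF assms]
  by (auto simp: almost_product_def F0_def gsections_def smul_def fun_eq_iff)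

text \<open>Symmetry is used to write both mixed terms with the vector field first, the form in
  which the vanishing condition is stated.\<close>

lemma generalized_metric_expand:
  assumes "generalized_metric A G" and "X \<in> vector_fields A" and "Y \<in> vector_fields A"
    and "\<xi> \<in> one_forms A" and "\<eta> \<in> one_forms A"
  shows "G (X, \<xi>) (Y, \<eta>) = G (X, 0) (Y, 0) + G (X, 0) (0, \<eta>) + G (Y, 0) (0, \<xi>) + G (0, \<xi>) (0, \<eta>)"
proof -
  have add: "G (u + v) w = G u w + G v w" "G w (u + v) = G w u + G w v" and sym: "G u v = G v u"
    if "u \<in> gsections A" "v \<in> gsections A" "w \<in> gsections A" for u v w
    using assms(1) that unfolding generalized_metric_def by blast+
  have sec: "(X, 0) \<in> gsections A" "(0, \<xi>) \<in> gsections A" "(Y, 0) \<in> gsections A" "(0, \<eta>) \<in> gsections A"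
    "(Y, \<eta>) \<in> gsections A"
    using assms by (auto simp: gsections_def zero_vector_fields zero_one_forms)
  have "G (X, \<xi>) (Y, \<eta>) = G (X, 0) (Y, \<eta>) + G (0, \<xi>) (Y, \<eta>)"
    using add(1)[of "(X, 0)" "(0, \<xi>)" "(Y, \<eta>)"] sec by simp
  moreover have "G (X, 0) (Y, \<eta>) = G (X, 0) (Y, 0) + G (X, 0) (0, \<eta>)"
    using add(2)[of "(Y, 0)" "(0, \<eta>)" "(X, 0)"] sec by simp
  moreover have "G (0, \<xi>) (Y, \<eta>) = G (Y, 0) (0, \<xi>) + G (0, \<xi>) (0, \<eta>)"
    using add(2)[of "(Y, 0)" "(0, \<eta>)" "(0, \<xi>)"] sym[of "(0, \<xi>)" "(Y, 0)"] sec by simp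
  ultimately show ?thesis
    by (simp only: add.assoc)
qed

lemma generalized_metric_uminus:
  assumes "smooth_atlas A" and "generalized_metric A G" and "X \<in> vector_fields A" and "u \<in> gsections A"
  shows "G (- X, 0) u = - G (X, 0) u" and "G u (- X, 0) = - G u (X, 0)"
proof -
  have "(X, 0) \<in> gsections A"
    using assms(3) by (simp add: gsections_def zero_one_forms)
  moreover have "(- X, 0) = smul (\<lambda>p. -1) (X, 0)"
    by (simp add: smul_def fun_eq_iff)
  ultimately show "G (- X, 0) u = - G (X, 0) u" "G u (- X, 0) = - G u (X, 0)"
    using assms(2,4) smooth_functions_const[of "-1" A]
    by (simp_all add: generalized_metric_def fun_eq_iff)
qed

lemma generalized_metric_F0:
  assumes "smooth_atlas A" and "generalized_metric A G" and "X \<in> vector_fields A" and "Y \<in> vector_fields A"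
    and "\<xi> \<in> one_forms A" and "\<eta> \<in> one_forms A"
  shows "G (F0 (X, \<xi>)) (F0 (Y, \<eta>))
    = G (X, 0) (Y, 0) - G (X, 0) (0, \<eta>) - G (Y, 0) (0, \<xi>) + G (0, \<xi>) (0, \<eta>)"
proof -
  have sec: "(Z, 0) \<in> gsections A" "(0, \<zeta>) \<in> gsections A"
    if "Z \<in> vector_fields A" "\<zeta> \<in> one_forms A" for Z \<zeta>
    using that by (auto simp: gsections_def zero_vector_fields zero_one_forms)
  show ?thesis
    using assms(3-6) generalized_metric_expand[OF assms(2), of "- X" "- Y" \<xi> \<eta>]
    by (simp add: F0_def uminus_vector_fields[OF assms(1)] sec[OF _ assms(5)] sec[OF assms(3)]
        generalized_metric_uminus[OF assms(1,2)])
qed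

text \<open>On a vector field and a 1-form, invariance reads
  \<open>- G(X,\<xi>) = G(X,\<xi>)\<close>. Conversely, the mixed terms are the only ones whose sign
  \<open>F0\<close> changes.\<close>

lemma F0_invariant_iff:
  assumes "smooth_atlas A" and "generalized_metric A G"
  shows "(\<forall>u\<in>gsections A. \<forall>v\<in>gsections A. G (F0 u) (F0 v) = G u v) \<longleftrightarrow>
    (\<forall>X\<in>vector_fields A. \<forall>\<xi>\<in>one_forms A. G (X, 0) (0, \<xi>) = 0)" (is "?L \<longleftrightarrow> ?R")
proof
  assume L: ?L
  show ?R
  proof (intro ballI)
    fix X \<xi> assume X: "X \<in> vector_fields A" and \<xi>: "\<xi> \<in> one_forms A"
    have "(X, 0) \<in> gsections A" "(0, \<xi>) \<in> gsections A"
      using X \<xi> by (auto simp: gsections_def zero_vector_fields zero_one_forms)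
    with L have "G (- X, 0) (0, \<xi>) = G (X, 0) (0, \<xi>)"
      by (force simp: F0_def)
    then show "G (X, 0) (0, \<xi>) = 0"
      using generalized_metric_uminus(1)[OF assms X \<open>(0, \<xi>) \<in> gsections A\<close>] by (simp add: fun_eq_iff)
  qed
next
  assume ?R
  then show ?L
    by (auto simp: gsections_def generalized_metric_F0[OF assms] generalized_metric_expand[OF assms(2)])
qed

text \<open>\<open>F0\<close> preserves the two pure terms, so anti-invariance makes each equal to
  its own negative. Conversely, once they vanish, only mixed terms remain, and these change
  sign.\<close>

lemma F0_anti_invariant_iff:
  assumes "smooth_atlas A" and "generalized_metric A G"
  shows "(\<forall>u\<in>gsections A. \<forall>v\<in>gsections A. G (F0 u) (F0 v) = - G u v) \<longleftrightarrow>
    (\<forall>X\<in>vector_fields A. \<forall>Y\<in>vector_fields A. G (X, 0) (Y, 0) = 0) \<and>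
    (\<forall>\<xi>\<in>one_forms A. \<forall>\<eta>\<in>one_forms A. G (0, \<xi>) (0, \<eta>) = 0)" (is "?L \<longleftrightarrow> ?R")
proof
  assume L: ?L
  show ?R
  proof (intro conjI ballI)
    fix X Y assume X: "X \<in> vector_fields A" and Y: "Y \<in> vector_fields A"
    have sec: "(X, 0) \<in> gsections A" "(Y, 0) \<in> gsections A" "(- Y, 0) \<in> gsections A"
      using X Y by (auto simp: gsections_def zero_one_forms uminus_vector_fields[OF assms(1)])
    with L have "G (- X, 0) (- Y, 0) = - G (X, 0) (Y, 0)"
      by (force simp: F0_def)
    then show "G (X, 0) (Y, 0) = 0"
      using generalized_metric_uminus(1)[OF assms X sec(3)] generalized_metric_uminus(2)[OF assms Y sec(1)]
      by (simp add: fun_eq_iff)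
  next
    fix \<xi> \<eta> assume "\<xi> \<in> one_forms A" "\<eta> \<in> one_forms A"
    then have "(0, \<xi>) \<in> gsections A" "(0, \<eta>) \<in> gsections A"
      by (auto simp: gsections_def zero_vector_fields)
    with L have "G (0, \<xi>) (0, \<eta>) = - G (0, \<xi>) (0, \<eta>)"
      by (force simp: F0_def)
    then show "G (0, \<xi>) (0, \<eta>) = 0"
      by (simp add: fun_eq_iff)
  qed
next
  assume ?R
  then show ?L
    by (auto simp: gsections_def generalized_metric_F0[OF assms] generalized_metric_expand[OF assms(2)])
qed

theorem proposition4p2:
  fixes A :: "('a::{t2_space, second_countable_topology}, 'b::euclidean_space) chart set"
    and G :: "'a gform"
  assumes "smooth_atlas A" and "generalized_metric A G"
  shows
    "(riemannian_metric A G \<longrightarrow>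
        (almost_para_norden A F0 G \<longleftrightarrow>
          (\<forall>X\<in>vector_fields A. \<forall>\<xi>\<in>one_forms A. G (X, 0) (0, \<xi>) = 0))) \<and>
     (pseudo_riemannian_metric A G \<longrightarrow>
        (pseudo_riemannian_almost_product A F0 G \<longleftrightarrow>
          (\<forall>X\<in>vector_fields A. \<forall>\<xi>\<in>one_forms A. G (X, 0) (0, \<xi>) = 0)) \<and>
        (almost_para_hermitian A F0 G \<longleftrightarrow>
          (\<forall>X\<in>vector_fields A. \<forall>Y\<in>vector_fields A. G (X, 0) (Y, 0) = 0) \<and>
          (\<forall>\<xi>\<in>one_forms A. \<forall>\<eta>\<in>one_forms A. G (0, \<xi>) (0, \<eta>) = 0)))"
  \<comment> \<open>\<open>F0\<close> is always an almost product structure, and the rank condition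
    holds for every Riemannian \<open>G\<close>. Each structure thus reduces to the invariance or
    anti-invariance of \<open>G\<close>.\<close>
  using almost_product_F0[OF assms(1)] F0_invariant_iff[OF assms] F0_anti_invariant_iff[OF assms]
    fibre_dim_eigen_fibre_F0[OF assms(1)] assms(2)
  by (simp add: almost_para_norden_def riemannian_almost_product_def
      pseudo_riemannian_almost_product_def almost_para_hermitian_def)

end
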